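(* Let $\bar x\in X^{\mathrm{net}}$ be a fixed integral assignment. For each trip $k\in\tilde N$ let $U_k=\{h\in H: s_k^h(\bar x)=1\}$ and let $G_k=(U_k,E_k)$ be the precedence digraph induced by the active coupling/decoupling instances under $\bar x$. Then the following are equivalent: (i) there exist order and comparison variables $(\theta,u)$ satisfying the order-linking constraints (with $x=\bar x$) and all ordering instances (coupling, decoupling and continuation) that are active under $\bar x$; (ii) there exists a continuation-consistent family of trip-wise orders $\Pi=\{\pi_k\}_{k\in\tilde N}$. In particular, if every $G_k$ is acyclic and topological orders of the digraphs $G_k$ can be chosen so as to be continuation-consistent on all active feasible arcs, then there exists a feasible order assignment $\theta$ (i.e. $(\theta,u)$ as in (i) for some $u$), and the corresponding schedule is blockage-free.
   Context: **Network.** $\tilde N$ is a finite set of trips; $0,\infty$ are an artificial source and sink; $N=\tilde N\cup\{0,\infty\}$. The finite arc set is $A=\tilde A\cup\{(0,j):j\in\tilde N\}\cup\{(j,\infty):j\in\tilde N\}$, where $\tilde A\subseteq\tilde N\times\tilde N$ is the set of turn-round arcs, and $(N,A)$ is a directed acyclic graph. $T$ is a finite set of unit types; $H_t$ is the finite set of individual units of type $t$, $b^t=|H_t|$, $H=\bigsqcup_{t\in T}H_t$. A family $f\in F$ is a set of types with size limit $v^f\in\mathbb Z_{\ge1}$; $F_j\subseteq F$ is the nonempty set of families feasible for trip $j$. Each unit $h$ has a feasible arc set $A^h\subseteq A$; an arc of $A^h$ may touch trip $j$ only if the type of $h$ belongs to some $f\in F_j$. $\delta_+^h(i)$, $\delta_-^h(i)$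 are the arcs of $A^h$ leaving, respectively entering, node $i$. Each trip $i$ has a direction $d_i\in\{-1,1\}$ and arrival/departure times $\tau_i^{arr},\tau_i^{dep}$; times that are compared in same-direction coupling/decoupling instances are assumed distinct (ties having been resolved beforehand). $\kappa^t$ is the capacity of type $t$, $r_j$ the demand of trip $j$. **Network constraints**, in binary variables $x_a^h$ ($h\in H,a\in A^h$) and $y_j^f$ ($j\in\tilde N,f\in F_j$): $\sum_{a\in\delta_+^h(0)}x_a^h\le1$ for all $h$; $\sum_{a\in\delta_+^h(j)}x_a^h=\sum_{a\in\delta_-^h(j)}x_a^h$ for all $h$ and $j\in\tilde N$; $\sum_{h\in H_t}\sum_{a\in\delta_+^h(0)}x_a^h\le b^t$ for all $t$; $\sum_t\sum_{h\in H_t}\sum_{a\in\delta_+^h(j)}\kappa^tx_a^h\ge r_j$ for all $j\in\tilde N$; $\sum_{t\in f}\sum_{h\in H_t}\sum_{a\in\delta_+^h(j)}x_a^h\le v^fy_j^f$ for all $j\in\tilde N,f\in F_j$; $\sum_{f\in F_j}y_j^f=1$ for all $j\in\tilde N$. $X^{\mathrm{net}}$ is the set of binary $x$ for which some binary $y$ satisfies these. **Notation.** $s_i^h=s_i^h(x)=\sum_{a\in\delta_+^h(i)}x_a^h$ (unit $h$ is active on trip $i$ iff $s_i^h=1$), $q_i=\sum_{h\in H}s_i^h$, $\bar q_i=\max_{f\in F_i}v^f$, $M_i=\bar q_i$. **Order-linking constraints**, in variables $\theta_i^h\in\{0,1,\dots,\bar q_i\}$ and $u_i^{h_1h_2}\in\{0,1\}$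 ($i\in\tilde N$, $h,h_1\ne h_2\in H$): $s_i^h\le\theta_i^h\le q_i$; $\theta_i^h\le M_is_i^h$; and $1-M_i(1-u_i^{h_1h_2})-M_i(2-s_i^{h_1}-s_i^{h_2})\le\theta_i^{h_1}-\theta_i^{h_2}\le M_iu_i^{h_1h_2}-1+M_i(2-s_i^{h_1}-s_i^{h_2})$. **Active ordering instances** under $\bar x$, for distinct units $h_1,h_2$. (If the input data mark some station events or arcs as permitting shunting/resequencing, the corresponding instances are removed from the model; "instance" below means a non-removed one.) - Coupling into trip $j$: for $a_1=(i_1,j)\in\tilde A$, $a_2=(i_2,j)\in\tilde A$ with $\bar x_{a_1}^{h_1}=\bar x_{a_2}^{h_2}=1$: (opposite direction) $d_j(d_{i_1}-d_{i_2})(\theta_j^{h_1}-\theta_j^{h_2})\ge0$; (same direction) $d_j(d_{i_1}+d_{i_2})(\tau_{i_1}^{arr}-\tau_{i_2}^{arr})(\theta_j^{h_1}-\theta_j^{h_2})\ge0$. - Decoupling from trip $i$: for $a_1=(i,j_1)\in\tilde A$, $a_2=(i,j_2)\in\tilde A$ with $\bar x_{a_1}^{h_1}=\bar x_{a_2}^{h_2}=1$: (opposite direction) $d_i(d_{j_1}-d_{j_2})(\theta_i^{h_1}-\theta_i^{h_2})\le0$; (same direction) $d_i(d_{j_1}+d_{j_2})(\tau_{j_1}^{dep}-\tau_{j_2}^{dep})(\theta_i^{h_1}-\theta_i^{h_2})\ge0$. - Continuation on $a=(i,j)\in\tilde A$ with $\bar x_a^{h_1}=\bar x_a^{h_2}=1$: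 $\theta_j^{h_1}-\theta_j^{h_2}=d_id_j(\theta_i^{h_1}-\theta_i^{h_2})$. **Precedence digraph.** Since active units on a trip have distinct positions, each active coupling/decoupling instance with nonzero coefficient on trip $k$ is equivalent to a strict requirement $\theta_k^a<\theta_k^b$ for one of the two orientations $(a,b)$ of the pair $\{h_1,h_2\}$. $E_k$ is the set of all pairs $(a,b)\in U_k\times U_k$ arising in this way, and $G_k=(U_k,E_k)$. **Continuation-consistent family.** A family of bijections $\Pi=\{\pi_k:U_k\to\{1,\dots,|U_k|\}\}_k$ is continuation-consistent if each $\pi_k$ is a topological order of $G_k$ (i.e. $\pi_k(a)<\pi_k(b)$ for all $(a,b)\in E_k$), and for every continuation instance active under $\bar x$, i.e. arc $a=(i,j)\in\tilde A$ and units $h_1\neq h_2$ with $\bar x_a^{h_1}=\bar x_a^{h_2}=1$, one has $\pi_j(h_1)-\pi_j(h_2)=d_id_j(\pi_i(h_1)-\pi_i(h_2))$. **Blockage-free.** A blockage is a violated active ordering instance (coupling, decoupling or continuation); a schedule $(\bar x,\theta)$ is blockage-free if no active ordering instance is violated. *)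

theory Defs
  imports Complex_Main "HOL-Library.Disjoint_Sets"
begin

section \<open>Problem data\<close>

datatype 'n node = Src | Trip 'n | Snk

type_synonym 'n arc = "'n node \<times> 'n node"

text \<open>
  An inequality on the order variables of one trip, stripped of the two units it is applied to.
  \<open>Coupling\<dots> i1 i2 j\<close> stands for the arcs \<open>(i1, j)\<close>, \<open>(i2, j)\<close> and \<open>Decoupling\<dots> i j1 j2\<close> for the
  arcs \<open>(i, j1)\<close>, \<open>(i, j2)\<close>.
\<close>

datatype 'n event =
    CouplingOpp 'n 'n 'n
  | CouplingSame 'n 'n 'n
  | DecouplingOpp 'n 'n 'n
  | DecouplingSame 'n 'n 'n

datatype ('n, 'h) inst =
    Event "'n event" 'h 'h
  | Continuation 'n 'n 'h 'h

text \<open>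
  Families are indexed (\<open>members\<close>, \<open>limit\<close>), so that two families may consist of the same types.
  \<open>units t\<close> is $H_t$ and \<open>feas h\<close> is $A^h$. The set \<open>removed\<close> collects the ordering instances that
  are dropped because the input data permit shunting or resequencing there; no structure is
  imposed on how the marked events and arcs determine it.
\<close>

record ('n, 't, 'f, 'h) network =
  trips :: "'n set"
  turns :: "('n \<times> 'n) set"
  types :: "'t set"
  units :: "'t \<Rightarrow> 'h set"
  families :: "'f set"
  members :: "'f \<Rightarrow> 't set"
  limit :: "'f \<Rightarrow> int"
  fams :: "'n \<Rightarrow> 'f set"
  feas :: "'h \<Rightarrow> 'n arc set"
  dir :: "'n \<Rightarrow> int"
  arr :: "'n \<Rightarrow> real"
  dep :: "'n \<Rightarrow> real"
  capacity :: "'t \<Rightarrow> real"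
  demand :: "'n \<Rightarrow> real"
  removed :: "('n, 'h) inst set"

definition all_units :: "('n, 't, 'f, 'h) network \<Rightarrow> 'h set" where
  "all_units P = (\<Union>t\<in>types P. units P t)"

definition arcs :: "('n, 't, 'f, 'h) network \<Rightarrow> 'n arc set" where
  "arcs P = {(Trip i, Trip j) | i j. (i, j) \<in> turns P}
    \<union> {(Src, Trip j) | j. j \<in> trips P} \<union> {(Trip j, Snk) | j. j \<in> trips P}"

fun event_arcs :: "'n event \<Rightarrow> ('n \<times> 'n) \<times> ('n \<times> 'n)" where
  "event_arcs (CouplingOpp i1 i2 j) = ((i1, j), (i2, j))"
| "event_arcs (CouplingSame i1 i2 j) = ((i1, j), (i2, j))"
| "event_arcs (DecouplingOpp i j1 j2) = ((i, j1), (i, j2))"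
| "event_arcs (DecouplingSame i j1 j2) = ((i, j1), (i, j2))"

fun inst_legs :: "('n, 'h) inst \<Rightarrow> ('h \<times> 'n \<times> 'n) \<times> ('h \<times> 'n \<times> 'n)" where
  "inst_legs (Event e h1 h2) = ((h1, fst (event_arcs e)), (h2, snd (event_arcs e)))"
| "inst_legs (Continuation i j h1 h2) = ((h1, i, j), (h2, i, j))"

definition instances :: "('n, 't, 'f, 'h) network \<Rightarrow> ('n, 'h) inst set" where
  "instances P = {I. I \<notin> removed P \<and>
    (case inst_legs I of ((h1, i1, j1), (h2, i2, j2)) \<Rightarrow>
      h1 \<in> all_units P \<and> h2 \<in> all_units P \<and> h1 \<noteq> h2 \<and>
      (i1, j1) \<in> turns P \<and> (Trip i1, Trip j1) \<in> feas P h1 \<and>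
      (i2, j2) \<in> turns P \<and> (Trip i2, Trip j2) \<in> feas P h2)}"

text \<open>
  The last two clauses express that times compared in same-direction instances are distinct. The
  case of equal trips is excluded: there both units use the same arc and nothing is compared.
\<close>

definition valid_network :: "('n, 't, 'f, 'h) network \<Rightarrow> bool" where
  "valid_network P \<longleftrightarrow>
    finite (trips P) \<and> turns P \<subseteq> trips P \<times> trips P \<and> acyclic (arcs P) \<and>
    finite (types P) \<and> (\<forall>t\<in>types P. finite (units P t)) \<and>
    disjoint_family_on (units P) (types P) \<and>
    finite (families P) \<and>
    (\<forall>f\<in>families P. members P f \<subseteq> types P \<and> limit P f \<ge> 1) \<and>
    (\<forall>j\<in>trips P. fams P j \<subseteq> families P \<and> fams P j \<noteq> {}) \<and>
    (\<forall>h\<in>all_units P. feas P h \<subseteq> arcs P) \<and>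
    (\<forall>t\<in>types P. \<forall>h\<in>units P t. \<forall>(v, w)\<in>feas P h. \<forall>j.
      v = Trip j \<or> w = Trip j \<longrightarrow> (\<exists>f\<in>fams P j. t \<in> members P f)) \<and>
    (\<forall>i\<in>trips P. dir P i \<in> {-1, 1}) \<and>
    (\<forall>i1 i2 j h1 h2. Event (CouplingSame i1 i2 j) h1 h2 \<in> instances P \<and>
      i1 \<noteq> i2 \<and> dir P i1 = dir P i2 \<longrightarrow> arr P i1 \<noteq> arr P i2) \<and>
    (\<forall>i j1 j2 h1 h2. Event (DecouplingSame i j1 j2) h1 h2 \<in> instances P \<and>
      j1 \<noteq> j2 \<and> dir P j1 = dir P j2 \<longrightarrow> dep P j1 \<noteq> dep P j2)"


section \<open>Network constraints\<close>

definition out_arcs :: "('n, 't, 'f, 'h) network \<Rightarrow> 'h \<Rightarrow> 'n node \<Rightarrow> 'n arc set" where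
  "out_arcs P h v = {a \<in> feas P h. fst a = v}"

definition in_arcs :: "('n, 't, 'f, 'h) network \<Rightarrow> 'h \<Rightarrow> 'n node \<Rightarrow> 'n arc set" where
  "in_arcs P h v = {a \<in> feas P h. snd a = v}"

definition out_flow ::
    "('n, 't, 'f, 'h) network \<Rightarrow> ('h \<Rightarrow> 'n arc \<Rightarrow> int) \<Rightarrow> 'h \<Rightarrow> 'n node \<Rightarrow> int" where
  "out_flow P x h v = (\<Sum>a\<in>out_arcs P h v. x h a)"

definition in_flow ::
    "('n, 't, 'f, 'h) network \<Rightarrow> ('h \<Rightarrow> 'n arc \<Rightarrow> int) \<Rightarrow> 'h \<Rightarrow> 'n node \<Rightarrow> int" where
  "in_flow P x h v = (\<Sum>a\<in>in_arcs P h v. x h a)"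

text \<open>
  Variables are total functions; they are constrained, and used, only on their index sets (such as
  \<open>a \<in> feas P h\<close> for \<open>x h a\<close>).
\<close>

definition network_constraints ::
    "('n, 't, 'f, 'h) network \<Rightarrow> ('h \<Rightarrow> 'n arc \<Rightarrow> int) \<Rightarrow> ('n \<Rightarrow> 'f \<Rightarrow> int) \<Rightarrow> bool" where
  "network_constraints P x y \<longleftrightarrow>
    (\<forall>h\<in>all_units P. out_flow P x h Src \<le> 1) \<and>
    (\<forall>h\<in>all_units P. \<forall>j\<in>trips P. out_flow P x h (Trip j) = in_flow P x h (Trip j)) \<and>
    (\<forall>t\<in>types P. (\<Sum>h\<in>units P t. out_flow P x h Src) \<le> int (card (units P t))) \<and>
    (\<forall>j\<in>trips P.
      (\<Sum>t\<in>types P. \<Sum>h\<in>units P t. \<Sum>a\<in>out_arcs P h (Trip j). capacity P t * real_of_int (x h a))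
        \<ge> demand P j) \<and>
    (\<forall>j\<in>trips P. \<forall>f\<in>fams P j.
      (\<Sum>t\<in>members P f. \<Sum>h\<in>units P t. out_flow P x h (Trip j)) \<le> limit P f * y j f) \<and>
    (\<forall>j\<in>trips P. (\<Sum>f\<in>fams P j. y j f) = 1)"

definition Xnet :: "('n, 't, 'f, 'h) network \<Rightarrow> ('h \<Rightarrow> 'n arc \<Rightarrow> int) set" where
  "Xnet P = {x. (\<forall>h\<in>all_units P. \<forall>a\<in>feas P h. x h a \<in> {0, 1}) \<and>
    (\<exists>y. (\<forall>j\<in>trips P. \<forall>f\<in>fams P j. y j f \<in> {0, 1}) \<and> network_constraints P x y)}"


section \<open>Order-linking constraints\<close>

definition act :: "('n, 't, 'f, 'h) network \<Rightarrow> ('h \<Rightarrow> 'n arc \<Rightarrow> int) \<Rightarrow> 'n \<Rightarrow> 'h \<Rightarrow> int" where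
  "act P x i h = out_flow P x h (Trip i)"

definition num_active :: "('n, 't, 'f, 'h) network \<Rightarrow> ('h \<Rightarrow> 'n arc \<Rightarrow> int) \<Rightarrow> 'n \<Rightarrow> int" where
  "num_active P x i = (\<Sum>h\<in>all_units P. act P x i h)"

definition max_units :: "('n, 't, 'f, 'h) network \<Rightarrow> 'n \<Rightarrow> int" where
  "max_units P i = Max (limit P ` fams P i)"

definition order_linking ::
    "('n, 't, 'f, 'h) network \<Rightarrow> ('h \<Rightarrow> 'n arc \<Rightarrow> int) \<Rightarrow>
     ('n \<Rightarrow> 'h \<Rightarrow> int) \<Rightarrow> ('n \<Rightarrow> 'h \<Rightarrow> 'h \<Rightarrow> int) \<Rightarrow> bool" where
  "order_linking P x \<theta> u \<longleftrightarrow>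
    (\<forall>i\<in>trips P. let M = max_units P i; s = act P x i in
      (\<forall>h\<in>all_units P.
        \<theta> i h \<in> {0..max_units P i} \<and>
        s h \<le> \<theta> i h \<and> \<theta> i h \<le> num_active P x i \<and> \<theta> i h \<le> M * s h) \<and>
      (\<forall>h1\<in>all_units P. \<forall>h2\<in>all_units P. h1 \<noteq> h2 \<longrightarrow>
        u i h1 h2 \<in> {0, 1} \<and>
        1 - M * (1 - u i h1 h2) - M * (2 - s h1 - s h2) \<le> \<theta> i h1 - \<theta> i h2 \<and>
        \<theta> i h1 - \<theta> i h2 \<le> M * u i h1 h2 - 1 + M * (2 - s h1 - s h2)))"


section \<open>Ordering instances\<close>

definition active_inst ::
    "('n, 't, 'f, 'h) network \<Rightarrow> ('h \<Rightarrow> 'n arc \<Rightarrow> int) \<Rightarrow> ('n, 'h) inst \<Rightarrow> bool" where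
  "active_inst P x I \<longleftrightarrow> I \<in> instances P \<and>
    (case inst_legs I of ((h1, i1, j1), (h2, i2, j2)) \<Rightarrow>
      x h1 (Trip i1, Trip j1) = 1 \<and> x h2 (Trip i2, Trip j2) = 1)"

fun event_trip :: "'n event \<Rightarrow> 'n" where
  "event_trip (CouplingOpp i1 i2 j) = j"
| "event_trip (CouplingSame i1 i2 j) = j"
| "event_trip (DecouplingOpp i j1 j2) = i"
| "event_trip (DecouplingSame i j1 j2) = i"

fun event_coeff :: "('n, 't, 'f, 'h) network \<Rightarrow> 'n event \<Rightarrow> real" where
  "event_coeff P (CouplingOpp i1 i2 j) = of_int (dir P j * (dir P i1 - dir P i2))"
| "event_coeff P (CouplingSame i1 i2 j) =
     of_int (dir P j * (dir P i1 + dir P i2)) * (arr P i1 - arr P i2)"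
| "event_coeff P (DecouplingOpp i j1 j2) = of_int (dir P i * (dir P j1 - dir P j2))"
| "event_coeff P (DecouplingSame i j1 j2) =
     of_int (dir P i * (dir P j1 + dir P j2)) * (dep P j1 - dep P j2)"

text \<open>Opposite-direction decoupling is the only event whose inequality is of the form \<open>\<le> 0\<close>.\<close>

fun event_ineq :: "'n event \<Rightarrow> real \<Rightarrow> bool" where
  "event_ineq (CouplingOpp i1 i2 j) c \<longleftrightarrow> c \<ge> 0"
| "event_ineq (CouplingSame i1 i2 j) c \<longleftrightarrow> c \<ge> 0"
| "event_ineq (DecouplingOpp i j1 j2) c \<longleftrightarrow> c \<le> 0"
| "event_ineq (DecouplingSame i j1 j2) c \<longleftrightarrow> c \<ge> 0"

fun satisfies ::
    "('n, 't, 'f, 'h) network \<Rightarrow> ('n \<Rightarrow> 'h \<Rightarrow> int) \<Rightarrow> ('n, 'h) inst \<Rightarrow> bool" where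
  "satisfies P \<theta> (Event e h1 h2) \<longleftrightarrow>
     event_ineq e (event_coeff P e * of_int (\<theta> (event_trip e) h1 - \<theta> (event_trip e) h2))"
| "satisfies P \<theta> (Continuation i j h1 h2) \<longleftrightarrow>
     \<theta> j h1 - \<theta> j h2 = dir P i * dir P j * (\<theta> i h1 - \<theta> i h2)"

definition blockage ::
    "('n, 't, 'f, 'h) network \<Rightarrow> ('h \<Rightarrow> 'n arc \<Rightarrow> int) \<Rightarrow> ('n \<Rightarrow> 'h \<Rightarrow> int) \<Rightarrow>
     ('n, 'h) inst \<Rightarrow> bool" where
  "blockage P x \<theta> I \<longleftrightarrow> active_inst P x I \<and> \<not> satisfies P \<theta> I"

definition blockage_free ::
    "('n, 't, 'f, 'h) network \<Rightarrow> ('h \<Rightarrow> 'n arc \<Rightarrow> int) \<Rightarrow> ('n \<Rightarrow> 'h \<Rightarrow> int) \<Rightarrow> bool" where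
  "blockage_free P x \<theta> \<longleftrightarrow> \<not> (\<exists>I. blockage P x \<theta> I)"


section \<open>Precedence digraphs and continuation-consistent families\<close>

definition active_units ::
    "('n, 't, 'f, 'h) network \<Rightarrow> ('h \<Rightarrow> 'n arc \<Rightarrow> int) \<Rightarrow> 'n \<Rightarrow> 'h set" where
  "active_units P x k = {h \<in> all_units P. act P x k h = 1}"

text \<open>
  An active coupling/decoupling instance contributes the orientation \<open>(a, b)\<close> of its pair of units
  for which, given distinct positions, the instance amounts to \<open>\<theta> k a < \<theta> k b\<close>.
\<close>

definition prec_edges ::
    "('n, 't, 'f, 'h) network \<Rightarrow> ('h \<Rightarrow> 'n arc \<Rightarrow> int) \<Rightarrow> 'n \<Rightarrow> ('h \<times> 'h) set" where
  "prec_edges P x k = {(a, b) \<in> active_units P x k \<times> active_units P x k.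
    \<exists>e h1 h2. active_inst P x (Event e h1 h2) \<and> event_trip e = k \<and> event_coeff P e \<noteq> 0 \<and>
      {h1, h2} = {a, b} \<and>
      (\<forall>\<theta>. \<theta> k a \<noteq> \<theta> k b \<longrightarrow> (satisfies P \<theta> (Event e h1 h2) \<longleftrightarrow> \<theta> k a < \<theta> k b))}"

definition topological_order :: "'h set \<Rightarrow> ('h \<times> 'h) set \<Rightarrow> ('h \<Rightarrow> nat) \<Rightarrow> bool" where
  "topological_order V E p \<longleftrightarrow> bij_betw p V {1..card V} \<and> (\<forall>(a, b)\<in>E. p a < p b)"

definition continuation_consistent ::
    "('n, 't, 'f, 'h) network \<Rightarrow> ('h \<Rightarrow> 'n arc \<Rightarrow> int) \<Rightarrow> ('n \<Rightarrow> 'h \<Rightarrow> nat) \<Rightarrow> bool" where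
  "continuation_consistent P x p \<longleftrightarrow>
    (\<forall>k\<in>trips P. topological_order (active_units P x k) (prec_edges P x k) (p k)) \<and>
    (\<forall>i j h1 h2. active_inst P x (Continuation i j h1 h2) \<longrightarrow>
      int (p j h1) - int (p j h2) = dir P i * dir P j * (int (p i h1) - int (p i h2)))"

end

theory Submission
  imports Defs
begin

text \<open>
  The two directions translate \<open>\<theta>\<close> and \<open>p\<close> into each other: on active units they coincide, and on
  inactive ones \<open>\<theta>\<close> vanishes. What makes this work is that every \<open>act P x k h\<close> is 0 or 1, which is
  not a constraint of the model but a consequence of acyclicity: a unit leaves the source at most
  once, so by flow conservation at most one unit of flow crosses the cut around the ancestors of a
  trip. The positions \<open>1, \<dots>, card (active_units P x k)\<close> then fit below \<open>max_units P k\<close> because all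
  active units have a type in the one selected family.
\<close>

text \<open>Turns a sum of node flows over a set of nodes into one sum over arcs, selected by tail
  or by head.\<close>

lemma sum_fibres:
  assumes "finite A" "finite S"
  shows "(\<Sum>v\<in>S. sum f {a \<in> A. g a = v}) = sum f {a \<in> A. g a \<in> S}"
proof -
  have "(\<Sum>v\<in>S. sum f {a \<in> A. g a = v}) = (\<Sum>v\<in>S. sum f {a \<in> {a \<in> A. g a \<in> S}. g a = v})"
    by (intro sum.cong) auto
  also have "\<dots> = sum f {a \<in> A. g a \<in> S}"
    using assms by (intro sum.group) auto
  finally show ?thesis .
qed

locale net_assignment =
  fixes P :: "('n, 't, 'f, 'h) network"
    and x :: "'h \<Rightarrow> 'n arc \<Rightarrow> int"
  assumes valid: "valid_network P"
    and net: "x \<in> Xnet P"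
begin

section \<open>Basic facts about the data and the constraints\<close>

lemma turns_trips: "(i, j) \<in> turns P \<Longrightarrow> i \<in> trips P \<and> j \<in> trips P"
  using valid by (auto simp: valid_network_def)

lemma feas_arcs: "h \<in> all_units P \<Longrightarrow> feas P h \<subseteq> arcs P"
  using valid by (auto simp: valid_network_def)

lemma finite_all_units: "finite (all_units P)"
  using valid by (auto simp: valid_network_def all_units_def)

lemma finite_arcs: "finite (arcs P)"
proof -
  have fin: "finite (trips P)" "finite (turns P)"
    using valid by (auto simp: valid_network_def intro: finite_subset)
  have "arcs P = (\<lambda>(i, j). (Trip i, Trip j)) ` turns P
      \<union> (\<lambda>j. (Src, Trip j)) ` trips P \<union> (\<lambda>j. (Trip j, Snk)) ` trips P"
    by (auto simp: arcs_def image_iff)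
  then show ?thesis
    using fin by simp
qed

lemma finite_feas: "h \<in> all_units P \<Longrightarrow> finite (feas P h)"
  using feas_arcs finite_arcs finite_subset by blast

lemma binary: "h \<in> all_units P \<Longrightarrow> a \<in> feas P h \<Longrightarrow> x h a = 0 \<or> x h a = 1"
  using net by (auto simp: Xnet_def)

lemma source_flow: "h \<in> all_units P \<Longrightarrow> out_flow P x h Src \<le> 1"
  using net by (auto simp: Xnet_def network_constraints_def)

lemma conservation:
  "h \<in> all_units P \<Longrightarrow> j \<in> trips P \<Longrightarrow> out_flow P x h (Trip j) = in_flow P x h (Trip j)"
  using net by (auto simp: Xnet_def network_constraints_def)

section \<open>Activity of a unit on a trip is binary\<close>

lemma act_nonneg: "h \<in> all_units P \<Longrightarrow> 0 \<le> act P x k h"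
  unfolding act_def out_flow_def
  by (rule sum_nonneg) (use binary in \<open>fastforce simp: out_arcs_def\<close>)

lemma act_le_1:
  assumes h: "h \<in> all_units P" and j: "j \<in> trips P"
  shows "act P x j h \<le> 1"
proof -
  \<comment> \<open>One side of the cut: the source and all proper ancestors of
    \<open>Trip j\<close>.\<close>
  define S where "S = insert Src {v. (v, Trip j) \<in> (arcs P)\<^sup>+}"
  define T where "T = {i \<in> trips P. Trip i \<in> S}"
  have fin: "finite (feas P h)" and finT: "finite T"
    using finite_feas[OF h] valid by (auto simp: T_def valid_network_def)
  \<comment> \<open>Conservation holds at trips only, so the sink must be kept out of
    \<open>S\<close>; it has no outgoing arc and is nobody's ancestor.\<close>
  have S_eq: "S = insert Src (Trip ` T)"
  proof -
    have "v = Src \<or> (\<exists>i\<in>trips P. v = Trip i)" if "(v, Trip j) \<in> (arcs P)\<^sup>+" for v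
      using that turns_trips by (induction rule: converse_trancl_induct) (auto simp: arcs_def)
    then show ?thesis
      by (auto simp: S_def T_def)
  qed
  have finS: "finite S"
    using finT S_eq by simp
  \<comment> \<open>No arc enters \<open>S\<close> from outside: ancestors are closed under
    predecessors, and the source has none.\<close>
  have no_return: "fst a \<in> S" if "a \<in> feas P h" "snd a \<in> S" for a
  proof -
    have a: "(fst a, snd a) \<in> arcs P"
      using that feas_arcs[OF h] by auto
    then have "snd a \<noteq> Src"
      by (auto simp: arcs_def)
    then have "(snd a, Trip j) \<in> (arcs P)\<^sup>+"
      using that by (simp add: S_def)
    then show ?thesis
      using trancl_into_trancl2[OF a] by (simp add: S_def)
  qed
  have j_notin: "Trip j \<notin> S"
    using valid by (auto simp: S_def valid_network_def acyclic_def)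
  have into_j: "fst a \<in> S" if "a \<in> feas P h" "snd a = Trip j" for a
  proof -
    have "(fst a, snd a) \<in> arcs P"
      using that(1) feas_arcs[OF h] by auto
    then show ?thesis
      using that(2) by (auto simp: S_def)
  qed
  have out_S: "(\<Sum>v\<in>S. out_flow P x h v) = sum (x h) {a \<in> feas P h. fst a \<in> S}"
    using fin finS by (simp add: out_flow_def out_arcs_def sum_fibres)
  have in_S: "(\<Sum>v\<in>S. in_flow P x h v) = sum (x h) {a \<in> feas P h. snd a \<in> S}"
    using fin finS by (simp add: in_flow_def in_arcs_def sum_fibres)
  have "in_arcs P h Src = {}"
    using feas_arcs[OF h] by (auto simp: in_arcs_def arcs_def)
  then have in_Src: "in_flow P x h Src = 0"
    by (simp add: in_flow_def)
  have trips_T: "(\<Sum>v\<in>Trip ` T. out_flow P x h v) = (\<Sum>v\<in>Trip ` T. in_flow P x h v)"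
    by (rule sum.cong) (use conservation[OF h] in \<open>auto simp: T_def\<close>)
  \<comment> \<open>Conservation cancels the flow at the trips of \<open>S\<close>, which leaves the
    source outflow as the only surplus.\<close>
  have bal: "(\<Sum>v\<in>S. out_flow P x h v) = out_flow P x h Src + (\<Sum>v\<in>S. in_flow P x h v)"
    unfolding S_eq using finT trips_T in_Src by (subst (1 2) sum.insert) auto
  \<comment> \<open>Arcs into \<open>j\<close> and arcs with head in \<open>S\<close> are disjoint,
    since \<open>j\<close> lies outside \<open>S\<close>, and all of them start in \<open>S\<close>.
    The flow internal to \<open>S\<close> then cancels against \<open>bal\<close>.\<close>
  have "act P x j h + sum (x h) {a \<in> feas P h. snd a \<in> S}
      = sum (x h) (in_arcs P h (Trip j) \<union> {a \<in> feas P h. snd a \<in> S})"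
    unfolding act_def conservation[OF h j] in_flow_def
    by (rule sum.union_disjoint[symmetric]) (use fin j_notin in \<open>auto simp: in_arcs_def\<close>)
  also have "\<dots> \<le> sum (x h) {a \<in> feas P h. fst a \<in> S}"
    by (rule sum_mono2) (use fin into_j no_return binary[OF h] in \<open>fastforce simp: in_arcs_def\<close>)+
  finally show ?thesis
    using bal out_S in_S source_flow[OF h] by linarith
qed

lemma act_binary: "h \<in> all_units P \<Longrightarrow> k \<in> trips P \<Longrightarrow> act P x k h = 0 \<or> act P x k h = 1"
  using act_nonneg[of h k] act_le_1[of h k] by linarith

text \<open>The arc is one summand of the outflow at its tail and of the inflow at its head. The
  other summands are nonnegative, so both activities are at least 1, and \<open>act_le_1\<close>
  caps them.\<close>

lemma active_on_arc:
  assumes h: "h \<in> all_units P" and arc: "(i, j) \<in> turns P" "(Trip i, Trip j) \<in> feas P h"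
    and x1: "x h (Trip i, Trip j) = 1"
  shows "h \<in> active_units P x i" "h \<in> active_units P x j"
proof -
  let ?a = "(Trip i, Trip j)"
  have trips: "i \<in> trips P" "j \<in> trips P"
    using turns_trips arc by auto
  have "x h ?a \<le> act P x i h"
    unfolding act_def out_flow_def using arc finite_feas[OF h] binary[OF h]
    by (intro member_le_sum) (fastforce simp: out_arcs_def)+
  then show "h \<in> active_units P x i"
    using act_le_1[OF h trips(1)] h x1 by (simp add: active_units_def)
  have "x h ?a \<le> act P x j h"
    unfolding act_def conservation[OF h trips(2)] in_flow_def
    using arc finite_feas[OF h] binary[OF h]
    by (intro member_le_sum) (fastforce simp: in_arcs_def)+
  then show "h \<in> active_units P x j"
    using act_le_1[OF h trips(2)] h x1 by (simp add: active_units_def)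
qed

text \<open>Both arcs of an event meet its trip, as head for a coupling and as tail for a
  decoupling, so \<open>active_on_arc\<close> applies to each unit.\<close>

lemma active_event_units:
  assumes "active_inst P x (Event e h1 h2)"
  shows "event_trip e \<in> trips P" "h1 \<noteq> h2"
    "h1 \<in> active_units P x (event_trip e)" "h2 \<in> active_units P x (event_trip e)"
  using assms turns_trips active_on_arc
  by (cases e; force simp: active_inst_def instances_def)+

lemma active_continuation_units:
  assumes "active_inst P x (Continuation i j h1 h2)"
  shows "i \<in> trips P" "j \<in> trips P"
    "{h1, h2} \<subseteq> active_units P x i" "{h1, h2} \<subseteq> active_units P x j"
  using assms turns_trips active_on_arc by (force simp: active_inst_def instances_def)+

section \<open>The number of active units and the size limits\<close>

lemma num_active_card:
  assumes "k \<in> trips P"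
  shows "num_active P x k = int (card (active_units P x k))"
proof -
  have "num_active P x k = (\<Sum>h\<in>all_units P. if act P x k h = 1 then 1 else 0)"
    unfolding num_active_def by (rule sum.cong) (use act_binary assms in force)+
  also have "\<dots> = int (card (active_units P x k))"
    using finite_all_units by (simp add: active_units_def sum.If_cases Int_def)
  finally show ?thesis .
qed

lemma fams_families:
  assumes "k \<in> trips P"
  shows "fams P k \<subseteq> families P" "fams P k \<noteq> {}" "finite (fams P k)"
proof -
  show "fams P k \<subseteq> families P" "fams P k \<noteq> {}"
    using valid assms by (simp_all add: valid_network_def)
  then show "finite (fams P k)"
    using valid by (auto simp: valid_network_def intro: finite_subset)
qed

lemma family_props:
  assumes "k \<in> trips P" "f \<in> fams P k"
  shows "members P f \<subseteq> types P" "1 \<le> limit P f"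
proof -
  have "f \<in> families P"
    using assms fams_families(1) by blast
  then show "members P f \<subseteq> types P" "1 \<le> limit P f"
    using valid by (simp_all add: valid_network_def)
qed

lemma max_units_ge:
  assumes "k \<in> trips P" "f \<in> fams P k"
  shows "limit P f \<le> max_units P k" "1 \<le> max_units P k"
proof -
  show "limit P f \<le> max_units P k"
    using assms fams_families by (auto simp: max_units_def)
  then show "1 \<le> max_units P k"
    using family_props[OF assms] by linarith
qed

lemma max_units_pos: "k \<in> trips P \<Longrightarrow> 1 \<le> max_units P k"
  using max_units_ge(2) fams_families(2) by blast

lemma num_active_le:
  assumes k: "k \<in> trips P"
  shows "num_active P x k \<le> max_units P k"
proof -
  obtain y where y01: "\<forall>j\<in>trips P. \<forall>f\<in>fams P j. y j f \<in> {0, 1}"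
    and constr: "network_constraints P x y"
    using net by (auto simp: Xnet_def)
  have y: "y k f \<in> {0, 1}" if "f \<in> fams P k" for f
    using y01 k that by blast
  have lim: "(\<Sum>t\<in>members P f. \<Sum>h\<in>units P t. act P x k h) \<le> limit P f * y k f"
    if "f \<in> fams P k" for f
    using constr k that by (simp add: network_constraints_def act_def)
  have one: "(\<Sum>f\<in>fams P k. y k f) = 1"
    using constr k by (simp add: network_constraints_def)
  note fin_fams = fams_families(3)[OF k] and fam = family_props(1)[OF k]
  have fin_types: "finite (types P)"
    and fin_units: "\<And>t. t \<in> types P \<Longrightarrow> finite (units P t)"
    and disj: "disjoint_family_on (units P) (types P)"
    using valid by (simp_all add: valid_network_def)
  have feasible: "\<exists>f\<in>fams P j. t \<in> members P f"
    if "t \<in> types P" "h \<in> units P t" "(Trip j, w) \<in> feas P h" for t h j w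
    using valid that unfolding valid_network_def by fast
  have nonneg: "0 \<le> act P x k h" if "t \<in> types P" "h \<in> units P t" for t h
    using that act_nonneg by (auto simp: all_units_def)
  obtain f where f: "f \<in> fams P k" "y k f = 1"
    using one y by (metis (no_types, lifting) insertE singletonD sum.neutral zero_neq_one)
  \<comment> \<open>Two selected families would already push the sum of the binary
    \<open>y k\<close> above 1.\<close>
  have unique: "g = f" if g: "g \<in> fams P k" "y k g = 1" for g
  proof (rule ccontr)
    assume "g \<noteq> f"
    then have "(\<Sum>f'\<in>{f, g}. y k f') \<le> (\<Sum>f'\<in>fams P k. y k f')"
      by (intro sum_mono2) (use fin_fams f g y in fastforce)+
    then show False
      using \<open>g \<noteq> f\<close> one f g by simp
  qed
  \<comment> \<open>An active unit uses an arc at \<open>k\<close>, so its type lies in some family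
    \<open>g\<close> feasible for \<open>k\<close>. Its positive flow is bounded by
    \<open>limit P g * y k g\<close>, which forces \<open>g\<close> to be the selected
    family.\<close>
  have in_f: "t \<in> members P f"
    if t: "t \<in> types P" and h: "h \<in> units P t" and pos: "act P x k h \<noteq> 0" for t h
  proof -
    have "out_arcs P h (Trip k) \<noteq> {}"
      using pos by (auto simp: act_def out_flow_def)
    then obtain w where "(Trip k, w) \<in> feas P h"
      by (auto simp: out_arcs_def)
    then obtain g where g: "g \<in> fams P k" "t \<in> members P g"
      using feasible t h by blast
    have types_g: "members P g \<subseteq> types P"
      using fam g by blast
    have "0 < act P x k h"
      using nonneg[OF t h] pos by simp
    also have "\<dots> \<le> (\<Sum>h\<in>units P t. act P x k h)"
      by (intro member_le_sum) (use fin_units nonneg t h in auto)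
    also have "\<dots> \<le> (\<Sum>t\<in>members P g. \<Sum>h\<in>units P t. act P x k h)"
      using g types_g fin_types nonneg
      by (intro member_le_sum[where f = "\<lambda>t. \<Sum>h\<in>units P t. act P x k h"])
        (auto intro!: sum_nonneg finite_subset[of _ "types P"])
    also have "\<dots> \<le> limit P g * y k g"
      using lim g by blast
    finally have "y k g = 1"
      using y g by fastforce
    then show ?thesis
      using unique g by blast
  qed
  have "num_active P x k = (\<Sum>t\<in>types P. \<Sum>h\<in>units P t. act P x k h)"
    unfolding num_active_def all_units_def
    by (rule sum.UNION_disjoint) (use fin_types fin_units disj in \<open>auto simp: disjoint_family_on_def\<close>)
  \<comment> \<open>By \<open>in_f\<close>, types outside the selected family contribute
    nothing.\<close>
  also have "\<dots> = (\<Sum>t\<in>members P f. \<Sum>h\<in>units P t. act P x k h)"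
    by (rule sum.mono_neutral_right)
      (use fin_types fam[OF f(1)] in_f in \<open>auto intro!: sum.neutral\<close>)
  also have "\<dots> \<le> limit P f"
    using lim f by fastforce
  also have "\<dots> \<le> max_units P k"
    using max_units_ge k f by blast
  finally show ?thesis .
qed

text \<open>A nonzero coefficient has a fixed sign, so the inequality is a weak comparison in one
  direction, strict once positions differ. The direction is the same for every \<theta>, as the
  quantifier in \<open>prec_edges\<close> requires.\<close>

lemma event_orientation:
  assumes "event_coeff P e \<noteq> 0"
  obtains "\<And>\<theta>. \<theta> (event_trip e) h1 \<noteq> \<theta> (event_trip e) h2 \<Longrightarrow>
      satisfies P \<theta> (Event e h1 h2) \<longleftrightarrow> \<theta> (event_trip e) h1 < \<theta> (event_trip e) h2"
  | "\<And>\<theta>. \<theta> (event_trip e) h1 \<noteq> \<theta> (event_trip e) h2 \<Longrightarrow>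
      satisfies P \<theta> (Event e h1 h2) \<longleftrightarrow> \<theta> (event_trip e) h2 < \<theta> (event_trip e) h1"
proof -
  let ?k = "event_trip e"
  have "event_ineq e = (\<lambda>c. c \<ge> 0) \<or> event_ineq e = (\<lambda>c. c \<le> 0)"
    by (cases e) auto
  moreover have "event_coeff P e > 0 \<or> event_coeff P e < 0"
    using assms by linarith
  ultimately have
    "(\<forall>\<theta>. satisfies P \<theta> (Event e h1 h2) \<longleftrightarrow> \<theta> ?k h1 \<le> \<theta> ?k h2) \<or>
     (\<forall>\<theta>. satisfies P \<theta> (Event e h1 h2) \<longleftrightarrow> \<theta> ?k h2 \<le> \<theta> ?k h1)"
    by (auto simp: zero_le_mult_iff mult_le_0_iff)
  then show thesis
    using that by (metis order_le_less)
qed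

section \<open>From order variables to trip-wise orders\<close>

lemma order_linking_imp_consistent:
  assumes link: "order_linking P x \<theta> u"
    and sat: "\<And>I. active_inst P x I \<Longrightarrow> satisfies P \<theta> I"
  shows "continuation_consistent P x (\<lambda>k h. nat (\<theta> k h))"
proof -
  let ?U = "active_units P x"
  have range: "1 \<le> \<theta> k h \<and> \<theta> k h \<le> int (card (?U k))"
    if "k \<in> trips P" "h \<in> ?U k" for k h
    using link that num_active_card[of k]
    by (fastforce simp: order_linking_def Let_def active_units_def)
  have distinct: "\<theta> k a \<noteq> \<theta> k b"
    if k: "k \<in> trips P" and ab: "a \<in> ?U k" "b \<in> ?U k" "a \<noteq> b" for k a b
  proof -
    have s: "a \<in> all_units P" "b \<in> all_units P" "act P x k a = 1" "act P x k b = 1"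
      using ab by (auto simp: active_units_def)
    \<comment> \<open>With both units active the big-M slack vanishes: \<open>u = 1\<close> forces a
      difference of at least 1, \<open>u = 0\<close> one of at most -1.\<close>
    have "u k a b \<in> {0, 1}"
      "1 - max_units P k * (1 - u k a b) - max_units P k * (2 - act P x k a - act P x k b)
        \<le> \<theta> k a - \<theta> k b"
      "\<theta> k a - \<theta> k b
        \<le> max_units P k * u k a b - 1 + max_units P k * (2 - act P x k a - act P x k b)"
      using link k s(1,2) ab(3) unfolding order_linking_def Let_def by blast+
    then show ?thesis
      using s by auto
  qed
  show ?thesis
    unfolding continuation_consistent_def topological_order_def
  proof (intro conjI ballI allI impI)
    fix k assume k: "k \<in> trips P"
    have inj: "inj_on (\<lambda>h. nat (\<theta> k h)) (?U k)"
    proof (rule inj_onI, rule ccontr)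
      fix a b assume ab: "a \<in> ?U k" "b \<in> ?U k" "nat (\<theta> k a) = nat (\<theta> k b)" "a \<noteq> b"
      show False
        using range[OF k ab(1)] range[OF k ab(2)] distinct[OF k ab(1,2,4)] ab(3) by linarith
    qed
    \<comment> \<open>An injective image inside a finite set of the same cardinality is the whole
      set.\<close>
    have "(\<lambda>h. nat (\<theta> k h)) ` ?U k \<subseteq> {1..card (?U k)}"
      using range[OF k] by force
    then have "(\<lambda>h. nat (\<theta> k h)) ` ?U k = {1..card (?U k)}"
      by (rule card_subset_eq[rotated]) (simp_all add: card_image[OF inj])
    then show "bij_betw (\<lambda>h. nat (\<theta> k h)) (?U k) {1..card (?U k)}"
      using inj by (simp add: bij_betw_def)
  next
    fix k ab assume k: "k \<in> trips P" and "ab \<in> prec_edges P x k"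
    then obtain a b e h1 h2 where ab: "ab = (a, b)" "a \<in> ?U k" "b \<in> ?U k"
      and e: "active_inst P x (Event e h1 h2)" "{h1, h2} = {a, b}"
      and iff: "\<theta> k a \<noteq> \<theta> k b \<longrightarrow> (satisfies P \<theta> (Event e h1 h2) \<longleftrightarrow> \<theta> k a < \<theta> k b)"
      unfolding prec_edges_def by blast
    have "a \<noteq> b"
      using active_event_units(2)[OF e(1)] e(2) by auto
    \<comment> \<open>The equivalence attached to the edge, taken at this \<theta>, makes the
      satisfied instance a strict inequality.\<close>
    then have "\<theta> k a < \<theta> k b"
      using iff distinct[OF k ab(2,3)] sat[OF e(1)] by blast
    then show "case ab of (a, b) \<Rightarrow> nat (\<theta> k a) < nat (\<theta> k b)"
      using range[OF k ab(2)] ab(1) by simp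
  next
    fix i j h1 h2 assume act: "active_inst P x (Continuation i j h1 h2)"
    \<comment> \<open>Nonnegativity ensures that \<open>nat\<close> truncates nothing, so the
      continuation equation carries over verbatim.\<close>
    have "0 \<le> \<theta> k h" if "k \<in> {i, j}" "h \<in> {h1, h2}" for k h
      using range[of k h] active_continuation_units[OF act] that by fastforce
    then show "int (nat (\<theta> j h1)) - int (nat (\<theta> j h2))
        = dir P i * dir P j * (int (nat (\<theta> i h1)) - int (nat (\<theta> i h2)))"
      using sat[OF act] by simp
  qed
qed

section \<open>From trip-wise orders to order variables\<close>

text \<open>The value 0 on inactive units is forced by the linking bound
  \<open>\<theta> i h \<le> M * s h\<close>.\<close>

definition order_of :: "('n \<Rightarrow> 'h \<Rightarrow> nat) \<Rightarrow> 'n \<Rightarrow> 'h \<Rightarrow> int" where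
  "order_of p k h = (if h \<in> active_units P x k then int (p k h) else 0)"

text \<open>The comparison variable is the indicator of \<open>h1\<close> having the larger
  position, the only choice possible for two active units.\<close>

lemma order_of_linking:
  assumes cons: "continuation_consistent P x p"
  shows "order_linking P x (order_of p)
    (\<lambda>k h1 h2. if order_of p k h2 < order_of p k h1 then 1 else 0)"
  unfolding order_linking_def Let_def
proof (intro ballI conjI impI)
  fix k assume k: "k \<in> trips P"
  let ?U = "active_units P x k" and ?M = "max_units P k" and ?\<theta> = "order_of p k"
  have bij: "bij_betw (p k) ?U {1..card ?U}"
    using cons k by (simp add: continuation_consistent_def topological_order_def)
  note M = max_units_pos[OF k] num_active_le[OF k] num_active_card[OF k]
  have unit: "act P x k h = 1 \<and> 1 \<le> ?\<theta> h \<and> ?\<theta> h \<le> num_active P x k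
      \<or> act P x k h = 0 \<and> ?\<theta> h = 0"
    if h: "h \<in> all_units P" for h
  proof (cases "h \<in> ?U")
    case True
    then show ?thesis
      using bij_betwE[OF bij] M(3) by (auto simp: order_of_def active_units_def)
  next
    case False
    then show ?thesis
      using act_binary[OF h k] h by (auto simp: order_of_def active_units_def)
  qed
  {
    fix h assume h: "h \<in> all_units P"
    show "?\<theta> h \<in> {0..?M}" "act P x k h \<le> ?\<theta> h" "?\<theta> h \<le> num_active P x k"
      "?\<theta> h \<le> ?M * act P x k h"
      using unit[OF h] M by auto
  }
  fix h1 h2 assume h: "h1 \<in> all_units P" "h2 \<in> all_units P" "h1 \<noteq> h2"
  have distinct: "?\<theta> h1 \<noteq> ?\<theta> h2" if "act P x k h1 = 1" "act P x k h2 = 1"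
    using that h bij by (auto simp: order_of_def active_units_def bij_betw_def inj_on_def)
  let ?u = "if ?\<theta> h2 < ?\<theta> h1 then 1 else 0 :: int"
  show "?u \<in> {0, 1}"
    by simp
  \<comment> \<open>Distinct positions in 1..M of two active units differ by between 1 and M - 1. If
    a unit is inactive, the slack of at least M suffices because positions lie in 0..M and
    \<open>1 \<le> M\<close>.\<close>
  show "1 - ?M * (1 - ?u) - ?M * (2 - act P x k h1 - act P x k h2) \<le> ?\<theta> h1 - ?\<theta> h2"
    "?\<theta> h1 - ?\<theta> h2 \<le> ?M * ?u - 1 + ?M * (2 - act P x k h1 - act P x k h2)"
    using unit[OF h(1)] unit[OF h(2)] distinct M by auto
qed

lemma order_of_satisfies:
  assumes cons: "continuation_consistent P x p"
    and act: "active_inst P x I"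
  shows "satisfies P (order_of p) I"
proof (cases I)
  case (Event e h1 h2)
  define k where "k = event_trip e"
  have act': "active_inst P x (Event e h1 h2)"
    using act Event by simp
  have k: "k \<in> trips P" and h: "h1 \<noteq> h2" "h1 \<in> active_units P x k" "h2 \<in> active_units P x k"
    using active_event_units[OF act'] by (auto simp: k_def)
  have edge: "order_of p k a < order_of p k b" if "(a, b) \<in> prec_edges P x k" for a b
  proof -
    have "p k a < p k b"
      using cons k that by (auto simp: continuation_consistent_def topological_order_def)
    then show ?thesis
      using that by (auto simp: order_of_def prec_edges_def)
  qed
  \<comment> \<open>Only the orientation has to be supplied; either order of the pair yields an edge
    of the digraph.\<close>
  have edgeI: "(a, b) \<in> prec_edges P x k"
    if "event_coeff P e \<noteq> 0" "{h1, h2} = {a, b}"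
      "\<And>\<theta>. \<theta> k a \<noteq> \<theta> k b \<Longrightarrow> satisfies P \<theta> (Event e h1 h2) \<longleftrightarrow> \<theta> k a < \<theta> k b" for a b
  proof -
    have "a \<in> active_units P x k" "b \<in> active_units P x k"
      using that(2) h by (auto simp: doubleton_eq_iff)
    then show ?thesis
      unfolding prec_edges_def using that act' k_def by blast
  qed
  show ?thesis
  proof (cases "event_coeff P e = 0")
    case True
    \<comment> \<open>With coefficient 0 the inequality compares 0 weakly with 0.\<close>
    then show ?thesis
      unfolding Event by (cases e) auto
  next
    case False
    then show ?thesis
    proof (cases rule: event_orientation[of e h1 h2])
      case 1
      then have "order_of p k h1 < order_of p k h2"
        using edge edgeI[OF False, of h1 h2] by (simp add: k_def)
      then show ?thesis
        using 1[of "order_of p"] unfolding Event k_def by simp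
    next
      case 2
      then have "order_of p k h2 < order_of p k h1"
        using edge edgeI[OF False, of h2 h1] by (auto simp: k_def)
      then show ?thesis
        using 2[of "order_of p"] unfolding Event k_def by simp
    qed
  qed
next
  case (Continuation i j h1 h2)
  \<comment> \<open>Both units are active on both trips, so \<open>order_of\<close> agrees with
    \<open>p\<close> at all four places.\<close>
  then show ?thesis
    using cons act active_continuation_units[of i j h1 h2]
    by (simp add: continuation_consistent_def order_of_def)
qed

end

theorem corollary4p6:
  fixes P :: "('n, 't, 'f, 'h) network"
    and xbar :: "'h \<Rightarrow> 'n arc \<Rightarrow> int"
  assumes "valid_network P"
    and "xbar \<in> Xnet P"
  shows "((\<exists>\<theta> u. order_linking P xbar \<theta> u \<and> (\<forall>I. active_inst P xbar I \<longrightarrow> satisfies P \<theta> I))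
            \<longleftrightarrow> (\<exists>p. continuation_consistent P xbar p))
    \<and> ((\<forall>k\<in>trips P. acyclic (prec_edges P xbar k)) \<and> (\<exists>p. continuation_consistent P xbar p)
         \<longrightarrow> (\<exists>\<theta>. (\<exists>u. order_linking P xbar \<theta> u \<and>
                        (\<forall>I. active_inst P xbar I \<longrightarrow> satisfies P \<theta> I))
                 \<and> blockage_free P xbar \<theta>))"
proof -
  interpret net_assignment P xbar
    using assms by unfold_locales
  show ?thesis
    \<comment> \<open>Unfolded, blockage-freeness says that all active instances are satisfied, so
      \<open>order_of p\<close> serves as witness for both claims.\<close>
    unfolding blockage_free_def blockage_def
    using order_linking_imp_consistent order_of_linking order_of_satisfies by blast
qed

end
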